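(* Let $n\geq 2$. Given any point $s:=(s_1,\dots,s_n)$ in the symmetrized polydisc $G_n$, define the rational function \[ F_s(z):=\frac{(-1)^n n s_n z^{n-1}+(-1)^{n-1}(n-1)s_{n-1}z^{n-2}+\dots+(-s_1)}{n-(n-1)s_1 z+\dots+(-1)^{n-1}s_{n-1}z^{n-1}},\quad z\in\mathbb{C}. \] Let $\zeta_1,\zeta_2\in D$ and $s\in G_n$. Then: 1) If there exists a map $f\in\mathcal{O}(D;G_n)$ such that $f(\zeta_1)=0$ and $f(\zeta_2)=s$, then \[ \max\left\{\inf\left\{t^n: t>0\ \text{and}\ \frac{1}{t}\sup_{|z|=1/t}|F_s(z)|<1\right\},\ \sup_{|z|=1}|F_s(z)|\right\}\ \leq\ \left|\frac{\zeta_2-\zeta_1}{1-\overline{\zeta_1}\zeta_2}\right|. \] 2) If \[ \inf\left\{t>0:\frac{1}{t}\sup_{|z|=1/t}|F_s(z)|<1\right\}\ \leq\ \left|\frac{\zeta_2-\zeta_1}{1-\overline{\zeta_1}\zeta_2}\right|, \] then there exists a map $f\in\mathcal{O}(D;G_n)$ such that $f(\zeta_1)=0$ and $f(\zeta_2)=s$.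
   Context: $D$ denotes the open unit disc in $\mathbb{C}$, and $\mathcal{O}(X;Y)$ the class of holomorphic maps from $X$ into $Y$. The symmetrized polydisc in $\mathbb{C}^n$ is \[ G_n:=\{(s_1,\dots,s_n)\in\mathbb{C}^n:\text{all the roots of } z^n-s_1z^{n-1}+\dots+(-1)^ns_n=0 \text{ lie in } D\}. \] In $F_s$, the numerator is $\sum_{j=1}^n(-1)^j j s_j z^{j-1}$ and the denominator is $n+\sum_{j=1}^{n-1}(-1)^j(n-j)s_jz^j$.
   Formalization: In both infima, t is also required to be such that F_s has no poles in |z| ≤ 1/t; without this, part 2 fails for n ≥ 3, e.g. n = 3, s = (a,0,0), 0 < |a| < 1, ζ1 = ζ2, where the printed infimum is 0 but s ≠ 0. *)

theory Defs
  imports "HOL-Complex_Analysis.Complex_Analysis"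
begin

text \<open>A point \<open>(s\<^sub>1, \<dots>, s\<^sub>n)\<close> of complex n-space is a function on the indices \<open>1, \<dots>, n\<close>,
  extended by 0 to all of \<open>nat\<close>, so that equality of points is equality of functions
  and the origin is \<open>\<lambda>_. 0\<close>.\<close>

definition cspace :: "nat \<Rightarrow> (nat \<Rightarrow> complex) set" where
  "cspace n = {s. \<forall>j. j \<notin> {1..n} \<longrightarrow> s j = 0}"

definition symm_polydisc :: "nat \<Rightarrow> (nat \<Rightarrow> complex) set" where
  "symm_polydisc n = {s \<in> cspace n.
     \<forall>z. z ^ n + (\<Sum>j=1..n. (-1) ^ j * s j * z ^ (n - j)) = 0 \<longrightarrow> z \<in> ball 0 1}"

text \<open>Maps from an open set \<open>X\<close> of the plane into a set \<open>Y\<close> of such points;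
  holomorphy is componentwise.\<close>

definition holomorphic_maps ::
    "complex set \<Rightarrow> (nat \<Rightarrow> complex) set \<Rightarrow> (complex \<Rightarrow> nat \<Rightarrow> complex) set" where
  "holomorphic_maps X Y =
     {f. (\<forall>z\<in>X. f z \<in> Y) \<and> (\<forall>j. (\<lambda>z. f z j) holomorphic_on X)}"

text \<open>Numerator and denominator may have common zeros (for instance if
  \<open>z ^ n - s\<^sub>1 z ^ (n - 1) + \<dots>\<close> has a nonzero multiple root), so the rational function is the
  quotient with its removable singularities removed. At a genuine pole \<^const>\<open>remove_sings\<close>
  returns 0; poles are excluded explicitly where \<open>F n s\<close> is used. On the closed unit disc there
  are none if \<open>s \<in> symm_polydisc n\<close>: up to the factor \<open>z ^ (n - 1)\<close>, the denominator is the
  derivative of the defining polynomial of \<open>s\<close> at \<open>1 / z\<close>, so the Gauss-Lucas theorem applies.\<close>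

definition F :: "nat \<Rightarrow> (nat \<Rightarrow> complex) \<Rightarrow> complex \<Rightarrow> complex" where
  "F n s = remove_sings (\<lambda>z.
     (\<Sum>j=1..n. (-1) ^ j * of_nat j * s j * z ^ (j - 1)) /
     (of_nat n + (\<Sum>j=1..n-1. (-1) ^ j * of_nat (n - j) * s j * z ^ j)))"

text \<open>The scales \<open>t > 0\<close> with \<open>(1/t) sup {\<bar>F n s z\<bar> : \<bar>z\<bar> = 1/t} < 1\<close>.
  The supremum over the circle stands, by the maximum principle, for the one over the disc
  \<open>\<bar>z\<bar> \<le> 1/t\<close>, which presupposes that \<open>F n s\<close> has no pole there; this is
  a requirement on \<open>t\<close>. Without it, arbitrarily small \<open>t\<close> may be admitted by circles that go
  around a pole: for \<open>n = 3\<close> and \<open>s = (a, 0, 0)\<close> with \<open>0 < \<bar>a\<bar> < 1\<close> we have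
  \<open>F n s z = - a / (3 - 2 a z)\<close>, and the bare inequality holds for all \<open>t < \<bar>a\<bar> / 3\<close>.\<close>

definition admissible_scales :: "nat \<Rightarrow> (nat \<Rightarrow> complex) \<Rightarrow> real set" where
  "admissible_scales n s =
     {t. t > 0 \<and> (\<forall>z\<in>cball 0 (1 / t). \<not> is_pole (F n s) z) \<and>
         1 / t * (SUP z\<in>sphere 0 (1 / t). norm (F n s z)) < 1}"

end

theory Submission
  imports Defs "HOL-Computational_Algebra.Fundamental_Theorem_Algebra"
begin

text \<open>Let \<open>r i\<close> be the roots belonging to \<open>s\<close> and \<open>P z = (\<Prod>i. 1 - r i * z)\<close>; then
  \<open>F n s z = P' z / (n * P z - z * P' z)\<close>. The admissible scales are exactly the \<open>t > 0\<close> larger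
  than all \<open>\<bar>r i\<bar>\<close>, so both infima are governed by the largest modulus \<open>\<rho>\<close> of a root. In part 1
  the Schwarz lemma gives \<open>\<bar>F n s z\<bar> \<le> \<bar>\<alpha>\<bar>\<close> on the unit circle, where \<open>\<alpha>\<close> is the Moebius transform of
  \<open>\<zeta>2\<close> that sends \<open>\<zeta>1\<close> to 0, and, applied to a Blaschke product over the roots, \<open>\<rho> ^ n \<le> \<bar>\<alpha>\<bar>\<close>.
  In part 2 the roots are multiplied by the Moebius transform of \<open>z\<close> divided by \<open>\<alpha>\<close>.\<close>

section \<open>Polynomials attached to a point, and their factorization over the roots\<close>

definition symm_poly :: "nat \<Rightarrow> (nat \<Rightarrow> complex) \<Rightarrow> complex poly" where
  "symm_poly n s = monom 1 n + (\<Sum>j=1..n. monom ((-1) ^ j * s j) (n - j))"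

definition recip_poly :: "nat \<Rightarrow> (nat \<Rightarrow> complex) \<Rightarrow> complex poly" where
  "recip_poly n s = 1 + (\<Sum>j=1..n. monom ((-1) ^ j * s j) j)"

text \<open>The polar derivative of \<open>recip_poly\<close> with respect to the point 0, taken for
  the formal degree \<open>n\<close>; it is the denominator of \<open>F\<close>.\<close>

definition polar_poly :: "nat \<Rightarrow> (nat \<Rightarrow> complex) \<Rightarrow> complex poly" where
  "polar_poly n s = smult (of_nat n) (recip_poly n s) - pCons 0 (pderiv (recip_poly n s))"

lemma poly_symm_poly:
  "poly (symm_poly n s) z = z ^ n + (\<Sum>j=1..n. (-1) ^ j * s j * z ^ (n - j))"
  by (simp add: symm_poly_def poly_sum poly_monom)

lemma poly_recip_poly:
  "poly (recip_poly n s) z = 1 + (\<Sum>j=1..n. (-1) ^ j * s j * z ^ j)"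
  by (simp add: recip_poly_def poly_sum poly_monom)

lemma poly_pderiv_recip_poly:
  "poly (pderiv (recip_poly n s)) z = (\<Sum>j=1..n. (-1) ^ j * of_nat j * s j * z ^ (j - 1))"
  by (simp add: recip_poly_def pderiv_add pderiv_monom higher_pderiv_sum[of 1, simplified] poly_sum poly_monom mult_ac
      del: One_nat_def)

lemma poly_polar_poly:
  "poly (polar_poly n s) z =
     of_nat n + (\<Sum>j=1..n-1. (-1) ^ j * of_nat (n - j) * s j * z ^ j)"
proof -
  have "poly (polar_poly n s) z = of_nat n +
      (\<Sum>j=1..n. of_nat n * ((-1) ^ j * s j * z ^ j)
                  - z * ((-1) ^ j * of_nat j * s j * z ^ (j - 1)))"
    by (simp add: polar_poly_def poly_pderiv_recip_poly poly_recip_poly sum_subtractf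
        sum_distrib_left algebra_simps del: One_nat_def)
  also have "(\<Sum>j=1..n. of_nat n * ((-1) ^ j * s j * z ^ j)
                  - z * ((-1) ^ j * of_nat j * s j * z ^ (j - 1)))
      = (\<Sum>j=1..n. (-1) ^ j * of_nat (n - j) * s j * z ^ j)"
  proof (rule sum.cong)
    fix j assume "j \<in> {1..n}"
    then have z: "z ^ j = z * z ^ (j - 1)"
      and nj: "of_nat (n - j) = (of_nat n - of_nat j :: complex)"
      by (auto simp: power_eq_if)
    show "of_nat n * ((-1) ^ j * s j * z ^ j) - z * ((-1) ^ j * of_nat j * s j * z ^ (j - 1))
        = (-1) ^ j * of_nat (n - j) * s j * z ^ j"
      unfolding z nj by (simp add: algebra_simps)
  qed simp
  \<comment> \<open>The term \<open>j = n\<close> drops out because of its factor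
    \<open>n - j\<close>.\<close>
  also have "\<dots> = (\<Sum>j=1..n-1. (-1) ^ j * of_nat (n - j) * s j * z ^ j)"
    by (rule sum.mono_neutral_right) (auto simp: not_le intro!: disjI1)
  finally show ?thesis .
qed

lemma F_eq:
  "F n s = remove_sings (\<lambda>z. poly (pderiv (recip_poly n s)) z / poly (polar_poly n s) z)"
  by (simp add: F_def poly_pderiv_recip_poly poly_polar_poly)

text \<open>Reversing the coefficients turns each factor \<open>z - r i\<close> into
  \<open>1 - r i * z\<close>, so one list of roots with multiplicity serves both polynomials. A root
  0 contributes the factor 1, which keeps the index set the same although the degree of
  \<open>recip_poly\<close> may drop.\<close>

lemma symm_poly_factor:
  obtains r where "symm_poly n s = (\<Prod>i<n. [:- r i, 1:])"
    and "recip_poly n s = (\<Prod>i<n. [:1, - r i:])"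
proof -
  let ?q = "\<Sum>j=1..n. monom ((-1) ^ j * s j) (n - j)"
  have q: "coeff ?q m = 0" if "n \<le> m" for m
    using that by (auto simp: coeff_sum intro!: sum.neutral)
  have deg: "degree (symm_poly n s) = n"
  proof (rule antisym)
    show "degree (symm_poly n s) \<le> n"
      by (rule degree_le) (simp add: symm_poly_def q del: One_nat_def)
    show "n \<le> degree (symm_poly n s)"
      by (rule le_degree) (simp add: symm_poly_def q del: One_nat_def)
  qed
  have lead: "coeff (symm_poly n s) n = 1"
    by (simp add: symm_poly_def q del: One_nat_def)
  obtain r where "smult (lead_coeff (symm_poly n s)) (\<Prod>i<degree (symm_poly n s). [:- r i, 1:])
      = symm_poly n s"
    by (rule complex_poly_decompose')
  then have r: "symm_poly n s = (\<Prod>i<n. [:- r i, 1:])"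
    by (simp only: deg lead smult_1_left)
  have "poly (recip_poly n s) z = poly (\<Prod>i<n. [:1, - r i:]) z" for z
  proof (cases "z = 0")
    case True
    then show ?thesis by (simp add: poly_recip_poly poly_prod)
  next
    case False
    have "poly (recip_poly n s) z = z ^ n * poly (symm_poly n s) (1 / z)"
    proof -
      have "z ^ n * ((-1) ^ j * s j * (1 / z) ^ (n - j)) = (-1) ^ j * s j * z ^ j"
        if "j \<in> {1..n}" for j
        using that False by (simp add: power_divide power_diff)
      then show ?thesis
        using False
        by (simp add: poly_recip_poly poly_symm_poly distrib_left sum_distrib_left power_divide
            del: One_nat_def)
    qed
    also have "\<dots> = (\<Prod>i<n. z * (1 / z - r i))"
      by (simp add: r poly_prod prod.distrib)
    also have "\<dots> = poly (\<Prod>i<n. [:1, - r i:]) z"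
      using False by (simp add: poly_prod right_diff_distrib)
    finally show ?thesis .
  qed
  then have "poly (recip_poly n s) = poly (\<Prod>i<n. [:1, - r i:])"
    by (rule ext)
  then have "recip_poly n s = (\<Prod>i<n. [:1, - r i:])"
    by (simp only: poly_eq_poly_eq_iff)
  with r show ?thesis by (rule that)
qed

lemma symm_polydisc_iff:
  "s \<in> symm_polydisc n \<longleftrightarrow> s \<in> cspace n \<and> (\<forall>w. poly (symm_poly n s) w = 0 \<longrightarrow> norm w < 1)"
  by (simp add: symm_polydisc_def poly_symm_poly)

lemma poly_recip_poly_eq_0:
  assumes "poly (recip_poly n s) z = 0"
  obtains w where "poly (symm_poly n s) w = 0" "w * z = 1"
proof -
  obtain r where r: "symm_poly n s = (\<Prod>i<n. [:- r i, 1:])"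
      "recip_poly n s = (\<Prod>i<n. [:1, - r i:])"
    by (rule symm_poly_factor)
  from assms obtain i where "i < n" "r i * z = 1"
    by (auto simp: r poly_prod mult.commute)
  then show ?thesis
    by (intro that[of "r i"]) (auto simp: r poly_prod)
qed

section \<open>Comparison of the numerator and the denominator of \<open>F\<close>\<close>

lemma Re_one_over_one_minus:
  assumes "norm (a :: complex) < 1"
  shows "Re (1 / (1 - a)) > 1 / 2"
proof -
  have "a \<noteq> 1" using assms by auto
  then have pos: "(1 - Re a)\<^sup>2 + (Im a)\<^sup>2 > 0"
    by (auto simp: complex_eq_iff sum_power2_gt_zero_iff)
  have "(Re a)\<^sup>2 + (Im a)\<^sup>2 < 1"
    using power_strict_mono[OF assms, of 2] by (simp add: cmod_power2)
  \<comment> \<open>Multiplied by twice the squared modulus of \<open>1 - a\<close>, the claim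
    becomes 2 (1 - Re a) > 1 - 2 Re a + |a|^2, that is, |a|^2 < 1.\<close>
  with pos show ?thesis
    by (simp add: Re_divide field_simps power2_eq_square)
qed

text \<open>With \<open>A = (\<Sum>i. 1 / (1 - r i * z))\<close>, the two sides are
  \<open>\<bar>P z\<bar> * \<bar>n - A\<bar>\<close> and \<open>\<bar>P z\<bar> * \<bar>A\<bar>\<close>, and \<open>Re A > n / 2\<close>.\<close>

lemma polar_poly_dominates:
  assumes "n > 0" and roots: "\<And>w. poly (symm_poly n s) w = 0 \<Longrightarrow> norm (w * z) < 1"
  shows "norm (z * poly (pderiv (recip_poly n s)) z) < norm (poly (polar_poly n s) z)"
proof -
  obtain r where r: "symm_poly n s = (\<Prod>i<n. [:- r i, 1:])"
      "recip_poly n s = (\<Prod>i<n. [:1, - r i:])"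
    by (rule symm_poly_factor)
  have small: "norm (r i * z) < 1" if "i < n" for i
    using that by (intro roots) (auto simp: r poly_prod)
  have nz: "1 - r i * z \<noteq> 0" if "i < n" for i
    using small[OF that] by auto
  define P where "P = poly (recip_poly n s) z"
  define A where "A = (\<Sum>i<n. 1 / (1 - r i * z))"
  have Peq: "poly (recip_poly n s) = (\<lambda>z. \<Prod>i<n. 1 - r i * z)"
    by (auto simp: r poly_prod mult.commute)
  have P0: "P \<noteq> 0"
    using nz by (simp add: P_def Peq)
  \<comment> \<open>Logarithmic derivative of the product, available because no factor vanishes at
    \<open>z\<close>.\<close>
  have "(poly (recip_poly n s) has_field_derivative P * (\<Sum>i<n. (- r i) / (1 - r i * z))) (at z)"
    unfolding P_def Peq using nz
    by (intro has_field_derivative_prod') (auto intro!: derivative_eq_intros)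
  then have P': "poly (pderiv (recip_poly n s)) z = P * (\<Sum>i<n. (- r i) / (1 - r i * z))"
    using poly_DERIV DERIV_unique by blast
  have "z * (\<Sum>i<n. (- r i) / (1 - r i * z)) = (\<Sum>i<n. 1 - 1 / (1 - r i * z))"
    unfolding sum_distrib_left using nz by (intro sum.cong) (auto simp: field_simps)
  also have "\<dots> = of_nat n - A"
    by (simp add: sum_subtractf A_def)
  finally have zP': "z * poly (pderiv (recip_poly n s)) z = P * (of_nat n - A)"
    unfolding P' by (simp add: mult_ac)
  have polar: "poly (polar_poly n s) z = P * A"
    using zP' by (simp add: polar_poly_def P_def algebra_simps)
  have "(\<Sum>i<n. 1 / 2) < (\<Sum>i<n. Re (1 / (1 - r i * z)))"
    using small \<open>n > 0\<close> by (intro sum_strict_mono Re_one_over_one_minus) auto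
  then have "Re A > of_nat n / 2"
    by (simp add: A_def)
  \<comment> \<open>Since |n - A|^2 = |A|^2 + n^2 - 2 n Re A, this says |n - A| < |A|.\<close>
  then have "real n * real n < 2 * real n * Re A"
    using \<open>n > 0\<close> by (simp add: field_simps)
  then have "norm (of_nat n - A) ^ 2 < norm A ^ 2"
    unfolding cmod_power2 by (simp add: power2_eq_square algebra_simps)
  then have "norm (of_nat n - A) < norm A"
    by (rule power_less_imp_less_base) simp
  then show ?thesis
    using P0 by (simp add: zP' polar norm_mult)
qed

section \<open>Analyticity and poles of \<open>F\<close>\<close>

lemma poly_analytic_on: "poly p analytic_on (A :: complex set)"
proof -
  have "poly p holomorphic_on UNIV"
    unfolding holomorphic_on_def field_differentiable_def
    by (blast intro: poly_DERIV has_field_derivative_at_within)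
  then show ?thesis
    by (meson analytic_on_open analytic_on_subset open_UNIV subset_UNIV)
qed

lemma polar_poly_nonzero:
  assumes "n > 0" shows "polar_poly n s \<noteq> 0"
proof -
  have "poly (polar_poly n s) 0 = of_nat n"
    unfolding poly_polar_poly by (simp add: power_0_left)
  then show ?thesis using assms by auto
qed

lemma F_analytic_if_polar_nonzero:
  assumes "poly (polar_poly n s) z \<noteq> 0"
  shows "F n s analytic_on {z}"
    and "F n s z = poly (pderiv (recip_poly n s)) z / poly (polar_poly n s) z"
proof -
  have "(\<lambda>z. poly (pderiv (recip_poly n s)) z / poly (polar_poly n s) z) analytic_on {z}"
    using assms by (intro analytic_intros poly_analytic_on) auto
  then show "F n s analytic_on {z}"
    and "F n s z = poly (pderiv (recip_poly n s)) z / poly (polar_poly n s) z"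
    by (simp_all add: F_eq remove_sings_analytic_on)
qed

text \<open>Removing the singularities of a meromorphic function leaves poles as the only
  obstruction to analyticity. This also covers common zeros of numerator and denominator, where the
  quotient formula is of no use.\<close>

lemma F_analytic_if_not_pole:
  assumes "\<not> is_pole (F n s) z"
  shows "F n s analytic_on {z}"
proof -
  have "(\<lambda>z. poly (pderiv (recip_poly n s)) z / poly (polar_poly n s) z) meromorphic_on UNIV"
    by (intro meromorphic_intros analytic_on_imp_meromorphic_on poly_analytic_on)
  then have "F n s nicely_meromorphic_on UNIV"
    unfolding F_eq by (rule remove_sings_nicely_meromorphic)
  then show ?thesis
    using assms by (intro nicely_meromorphic_on_imp_analytic_at[of _ UNIV]) auto
qed

section \<open>Admissible scales and the moduli of the roots\<close>

lemma admissible_if_roots_less: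
  assumes "n > 0" "t > 0" and roots: "\<And>w. poly (symm_poly n s) w = 0 \<Longrightarrow> norm w < t"
  shows "t \<in> admissible_scales n s"
proof -
  have dom: "norm (z * poly (pderiv (recip_poly n s)) z) < norm (poly (polar_poly n s) z)"
    if "z \<in> cball 0 (1 / t)" for z
  proof (rule polar_poly_dominates[OF \<open>n > 0\<close>])
    fix w assume "poly (symm_poly n s) w = 0"
    then have "norm w < t" by (rule roots)
    moreover have "norm z \<le> 1 / t" using that by simp
    ultimately have "norm w * norm z < t * (1 / t)"
      using \<open>t > 0\<close>
      by (intro le_less_trans[OF mult_left_mono mult_strict_right_mono]) auto
    then show "norm (w * z) < 1"
      using \<open>t > 0\<close> by (simp add: norm_mult)
  qed
  have nz: "poly (polar_poly n s) z \<noteq> 0" if "z \<in> cball 0 (1 / t)" for z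
    using dom[OF that] by (metis norm_ge_zero norm_zero not_le)
  have ana: "F n s analytic_on cball 0 (1 / t)"
    using F_analytic_if_polar_nonzero(1)[OF nz] by (subst analytic_on_analytic_at) blast
  have npole: "\<not> is_pole (F n s) z" if "z \<in> cball 0 (1 / t)" for z
    using F_analytic_if_polar_nonzero(1)[OF nz[OF that]] analytic_at_imp_no_pole by blast
  \<comment> \<open>On this circle the factor \<open>z\<close> in the domination estimate has
    modulus \<open>1 / t\<close>, and dividing by it produces the bound \<open>t\<close>.\<close>
  have lt: "norm (F n s z) < t" if "z \<in> sphere 0 (1 / t)" for z
  proof -
    from that have z: "z \<in> cball 0 (1 / t)" and nm: "norm z = 1 / t" by auto
    show ?thesis
      using dom[OF z] nz[OF z] \<open>t > 0\<close>
      by (simp add: F_analytic_if_polar_nonzero(2)[OF nz[OF z]] norm_divide norm_mult nm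
          field_simps)
  qed
  have ne: "sphere (0 :: complex) (1 / t) \<noteq> {}"
    using \<open>t > 0\<close> by simp
  \<comment> \<open>Pointwise strict bounds give only a weak bound for a supremum, so a point of the
    compact circle where the maximum is attained is used.\<close>
  have "continuous_on (sphere 0 (1 / t)) (\<lambda>z. norm (F n s z))"
    using ana by (intro continuous_on_norm holomorphic_on_imp_continuous_on
        analytic_imp_holomorphic analytic_on_subset[OF ana]) auto
  then obtain z where z: "z \<in> sphere 0 (1 / t)"
      "\<And>y. y \<in> sphere 0 (1 / t) \<Longrightarrow> norm (F n s y) \<le> norm (F n s z)"
    using continuous_attains_sup[OF compact_sphere ne] by blast
  have "(SUP z\<in>sphere 0 (1 / t). norm (F n s z)) \<le> norm (F n s z)"
    using ne z by (intro cSUP_least) auto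
  also have "\<dots> < t"
    by (rule lt[OF z(1)])
  finally show ?thesis
    using \<open>t > 0\<close> npole by (simp add: admissible_scales_def)
qed

text \<open>The identity \<open>(1 + z * F z) * P' z = n * F z * P z\<close> shows that \<open>P\<close> has no zero where
  \<open>F\<close> is analytic and \<open>1 + z * F z \<noteq> 0\<close>, since a zero of \<open>P\<close> has smaller order in \<open>P'\<close>.\<close>

lemma roots_less_if_admissible:
  assumes "n > 0" and t: "t \<in> admissible_scales n s" and root: "poly (symm_poly n s) w = 0"
  shows "norm w < t"
proof (rule ccontr)
  assume "\<not> norm w < t"
  from t have "t > 0" and npole: "\<And>z. z \<in> cball 0 (1 / t) \<Longrightarrow> \<not> is_pole (F n s) z"
    and sup: "1 / t * (SUP z\<in>sphere 0 (1 / t). norm (F n s z)) < 1"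
    by (auto simp: admissible_scales_def)
  with \<open>\<not> norm w < t\<close> have "w \<noteq> 0" by auto
  define P where "P = recip_poly n s"
  define z0 where "z0 = 1 / w"
  have z0: "z0 \<in> cball 0 (1 / t)"
    using \<open>\<not> norm w < t\<close> \<open>t > 0\<close> \<open>w \<noteq> 0\<close>
    by (simp add: z0_def norm_divide divide_simps)
  obtain r where r: "symm_poly n s = (\<Prod>i<n. [:- r i, 1:])"
      "recip_poly n s = (\<Prod>i<n. [:1, - r i:])"
    by (rule symm_poly_factor)
  have Pz0: "poly P z0 = 0"
    using root \<open>w \<noteq> 0\<close> by (auto simp: P_def r poly_prod z0_def)
  have "poly P 0 = 1"
    by (simp add: P_def r poly_prod)
  then have "P \<noteq> 0" by auto
  have ana: "F n s analytic_on cball 0 (1 / t)"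
    using F_analytic_if_not_pole[OF npole] by (subst analytic_on_analytic_at) blast
  then have cont: "continuous_on (cball 0 (1 / t)) (F n s)"
    by (intro holomorphic_on_imp_continuous_on analytic_imp_holomorphic)
  let ?S = "SUP z\<in>sphere 0 (1 / t). norm (F n s z)"
  have "bdd_above ((\<lambda>z. norm (F n s z)) ` sphere 0 (1 / t))"
    by (intro bounded_imp_bdd_above compact_imp_bounded compact_continuous_image
        continuous_on_norm continuous_on_subset[OF cont]) auto
  then have le: "norm (F n s z) \<le> ?S" if "z \<in> sphere 0 (1 / t)" for z
    using that by (intro cSUP_upper)
  \<comment> \<open>The zero \<open>z0\<close> of \<open>P\<close> may lie inside the circle; the
    maximum principle carries the bound to it, as \<open>F\<close> has no pole in the disc.\<close>
  have "norm (F n s z0) \<le> ?S"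
  proof (rule maximum_modulus_frontier[where f = "F n s" and S = "cball 0 (1 / t)"])
    show "F n s holomorphic_on interior (cball 0 (1 / t))"
      using ana interior_subset by (metis analytic_imp_holomorphic analytic_on_subset)
    show "norm (F n s z) \<le> ?S" if "z \<in> frontier (cball 0 (1 / t))" for z
      using that le by simp
  qed (use z0 cont in auto)
  also have "?S < t"
    using sup \<open>t > 0\<close> by (simp add: field_simps)
  finally have "norm (F n s z0) < t" .
  then have "norm z0 * norm (F n s z0) < 1 / t * t"
    using z0 \<open>w \<noteq> 0\<close> by (intro mult_le_less_imp_less) (auto simp: z0_def)
  then have "norm (z0 * F n s z0) < 1"
    using \<open>t > 0\<close> by (simp add: norm_mult)
  then have unit: "1 + z0 * F n s z0 \<noteq> 0"
    by (metis add_eq_0_iff norm_minus_cancel norm_one order_less_irrefl)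
  define k where "k = order z0 (pderiv P)"
  have ordP: "order z0 P = Suc k"
    using order_pderiv[OF \<open>P \<noteq> 0\<close> Pz0] by (simp add: k_def)
  obtain R where R: "P = [:- z0, 1:] ^ Suc k * R"
    using order_decomp[OF \<open>P \<noteq> 0\<close>, of z0] ordP by auto
  have PR: "poly P z = (z - z0) ^ Suc k * poly R z" for z
    by (subst R) (simp add: algebra_simps)
  have "pderiv P \<noteq> 0"
  proof
    assume "pderiv P = 0"
    then obtain c where "P = [:c:]"
      by (auto simp: pderiv_eq_0_iff elim: degree_eq_zeroE)
    with Pz0 \<open>poly P 0 = 1\<close> show False by simp
  qed
  then obtain Q where Q: "pderiv P = [:- z0, 1:] ^ k * Q" and "\<not> [:- z0, 1:] dvd Q"
    using order_decomp[of "pderiv P" z0] by (auto simp: k_def)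
  then have Qz0: "poly Q z0 \<noteq> 0"
    by (simp add: poly_eq_0_iff_dvd)
  have "eventually (\<lambda>z. z \<noteq> z0) (at z0)"
    by (simp add: eventually_at_filter)
  moreover have "eventually (\<lambda>z. poly (polar_poly n s) z \<noteq> 0) (at z0)"
    using islimpt_finite[OF poly_roots_finite[OF polar_poly_nonzero[OF \<open>n > 0\<close>, of s]], of z0]
    by (simp add: islimpt_iff_eventually)
  \<comment> \<open>The identity between \<open>P\<close> and its derivative with the common factor
    \<open>(z - z0) ^ k\<close> cancelled. One factor \<open>z - z0\<close> survives on the
    right.\<close>
  ultimately have ev: "eventually (\<lambda>z. (1 + z * F n s z) * poly Q z
      = of_nat n * F n s z * ((z - z0) * poly R z)) (at z0)"
  proof eventually_elim
    case (elim z)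
    have "F n s z * poly (polar_poly n s) z = poly (pderiv P) z"
      using F_analytic_if_polar_nonzero(2)[OF elim(2)] elim(2) by (simp add: P_def)
    then have "(1 + z * F n s z) * poly (pderiv P) z = of_nat n * F n s z * poly P z"
      by (simp add: polar_poly_def P_def algebra_simps)
    then have "(z - z0) ^ k * ((1 + z * F n s z) * poly Q z)
        = (z - z0) ^ k * (of_nat n * F n s z * ((z - z0) * poly R z))"
      unfolding PR Q by (simp add: mult_ac)
    then show ?case
      using elim(1) by simp
  qed
  have "isCont (F n s) z0"
    using F_analytic_if_not_pole[OF npole[OF z0]] by (rule analytic_at_imp_isCont)
  then have lim: "(F n s \<longlongrightarrow> F n s z0) (at z0)"
    by (rule isContD)
  have "((\<lambda>z. (1 + z * F n s z) * poly Q z) \<longlongrightarrow> (1 + z0 * F n s z0) * poly Q z0) (at z0)"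
    by (intro tendsto_intros lim)
  moreover have "((\<lambda>z. of_nat n * F n s z * ((z - z0) * poly R z)) \<longlongrightarrow>
      of_nat n * F n s z0 * ((z0 - z0) * poly R z0)) (at z0)"
    by (intro tendsto_intros lim)
  ultimately have "(1 + z0 * F n s z0) * poly Q z0 = of_nat n * F n s z0 * ((z0 - z0) * poly R z0)"
    using tendsto_unique[OF trivial_limit_at] tendsto_cong[OF ev] by blast
  then show False
    using unit Qz0 by simp
qed

section \<open>Necessary conditions from the Schwarz lemma\<close>

lemma Schwarz_Lemma_at:
  assumes holf: "f holomorphic_on ball 0 1" and fD: "\<And>z. z \<in> ball 0 1 \<Longrightarrow> f z \<in> ball 0 1"
    and ab: "a \<in> ball 0 1" "b \<in> ball 0 1" and "f a = 0"
  shows "norm (f b) \<le> norm (Moebius_function 0 a b)"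
proof -
  \<comment> \<open>\<open>Moebius_function 0 (- a)\<close> inverts
    \<open>Moebius_function 0 a\<close>, so \<open>?g\<close> fixes 0 and takes the value
    \<open>f b\<close> at \<open>Moebius_function 0 a b\<close>.\<close>
  let ?g = "f \<circ> Moebius_function 0 (- a)"
  have M: "Moebius_function 0 (- a) ` ball 0 1 \<subseteq> ball 0 1"
    using ab Moebius_function_norm_lt_1 by auto
  have "?g holomorphic_on ball 0 1"
    using ab M by (intro holomorphic_on_compose_gen[OF Moebius_function_holomorphic holf]) auto
  moreover have "?g 0 = 0"
    using \<open>f a = 0\<close> by (simp add: Moebius_function_of_zero)
  moreover have "norm (?g z) < 1" if "norm z < 1" for z
    using fD M that by (fastforce simp: image_subset_iff)
  moreover have "norm (Moebius_function 0 a b) < 1"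
    using ab by (intro Moebius_function_norm_lt_1) auto
  ultimately have "norm (?g (Moebius_function 0 a b)) \<le> norm (Moebius_function 0 a b)"
    by (rule Schwarz_Lemma(1))
  then show ?thesis
    using ab by (simp add: Moebius_function_compose)
qed

lemma norm_Moebius_function_commute:
  "norm (Moebius_function 0 a b) = norm (Moebius_function 0 b a)"
proof -
  have "norm (1 - cnj a * b) = norm (cnj (1 - cnj a * b))"
    by (simp only: complex_mod_cnj)
  then show ?thesis
    by (simp add: Moebius_function_simple norm_divide norm_minus_commute mult.commute)
qed

context
  fixes n :: nat and f :: "complex \<Rightarrow> nat \<Rightarrow> complex" and a b :: complex
  assumes n: "n > 0" and f: "f \<in> holomorphic_maps (ball 0 1) (symm_polydisc n)"
    and ab: "a \<in> ball 0 1" "b \<in> ball 0 1" and fa: "f a = (\<lambda>_. 0)"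
begin

lemma holomorphic_components [holomorphic_intros]: "(\<lambda>z. f z j) holomorphic_on ball 0 1"
  using f by (simp add: holomorphic_maps_def)

lemma norm_root_less_1:
  "z \<in> ball 0 1 \<Longrightarrow> poly (symm_poly n (f z)) w = 0 \<Longrightarrow> norm w < 1"
  using f by (simp add: holomorphic_maps_def symm_polydisc_iff)

text \<open>For fixed \<open>w\<close> on the unit circle, \<open>F n (f z) w\<close> depends
  holomorphically on \<open>z\<close> and vanishes at \<open>a\<close>; the domination of the
  numerator by the denominator keeps it in the unit disc.\<close>

lemma norm_F_le:
  assumes "norm w = 1"
  shows "norm (F n (f b) w) \<le> norm (Moebius_function 0 a b)"
proof (rule Schwarz_Lemma_at[OF _ _ ab])
  have dom: "norm (poly (pderiv (recip_poly n (f z))) w) < norm (poly (polar_poly n (f z)) w)"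
    if "z \<in> ball 0 1" for z
    using polar_poly_dominates[OF n, of "f z" w] norm_root_less_1[OF that] assms
    by (simp add: norm_mult)
  have nz: "poly (polar_poly n (f z)) w \<noteq> 0" if "z \<in> ball 0 1" for z
    using dom[OF that] by (metis norm_ge_zero norm_zero not_le)
  note F = F_analytic_if_polar_nonzero(2)[OF nz]
  have "(\<lambda>z. poly (pderiv (recip_poly n (f z))) w / poly (polar_poly n (f z)) w)
      holomorphic_on ball 0 1"
    using nz unfolding poly_pderiv_recip_poly poly_polar_poly by (intro holomorphic_intros) auto
  then show "(\<lambda>z. F n (f z) w) holomorphic_on ball 0 1"
    by (rule holomorphic_transform) (use F in auto)
  show "F n (f z) w \<in> ball 0 1" if "z \<in> ball 0 1" for z
    using dom[OF that] nz[OF that] by (simp add: F[OF that] norm_divide)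
  show "F n (f a) w = 0"
    using F[OF ab(1)] by (simp add: fa poly_pderiv_recip_poly)
qed

text \<open>The Schwarz lemma is applied to the Blaschke product
  \<open>\<Prod>i. (w - r i) / (1 - cnj w * r i)\<close> over the roots \<open>r i\<close> belonging to \<open>f z\<close>: as a symmetric
  function of the roots it is holomorphic in \<open>z\<close>, and it maps \<open>a\<close> to \<open>w ^ n\<close> and \<open>b\<close> to 0.\<close>

lemma norm_root_power_le:
  assumes w: "poly (symm_poly n (f b)) w = 0"
  shows "norm w ^ n \<le> norm (Moebius_function 0 a b)"
proof -
  \<comment> \<open>The Blaschke product expressed through the coordinates of \<open>f z\<close>, so
    that holomorphy requires no holomorphic choice of the roots.\<close>
  let ?h = "\<lambda>z. poly (symm_poly n (f z)) w / poly (recip_poly n (f z)) (cnj w)"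
  have w1: "norm w < 1"
    using norm_root_less_1[OF ab(2) w] .
  have nz: "poly (recip_poly n (f z)) (cnj w) \<noteq> 0" if "z \<in> ball 0 1" for z
  proof
    assume "poly (recip_poly n (f z)) (cnj w) = 0"
    then obtain v where "poly (symm_poly n (f z)) v = 0" and v: "v * cnj w = 1"
      by (rule poly_recip_poly_eq_0)
    then have "norm v < 1"
      using norm_root_less_1[OF that] by blast
    then have "norm (v * cnj w) < 1"
      using w1 by (intro norm_mult_less[of _ 1 _ 1, simplified]) auto
    with v show False by simp
  qed
  \<comment> \<open>The roles of \<open>a\<close> and \<open>b\<close> are exchanged, because
    \<open>?h\<close> has its zero at \<open>b\<close>.\<close>
  have "norm (?h a) \<le> norm (Moebius_function 0 b a)"
  proof (rule Schwarz_Lemma_at[OF _ _ ab(2,1)])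
    show "?h holomorphic_on ball 0 1"
      using nz unfolding poly_symm_poly poly_recip_poly by (intro holomorphic_intros) auto
    show "?h z \<in> ball 0 1" if z: "z \<in> ball 0 1" for z
    proof -
      obtain r where r: "symm_poly n (f z) = (\<Prod>i<n. [:- r i, 1:])"
          "recip_poly n (f z) = (\<Prod>i<n. [:1, - r i:])"
        by (rule symm_poly_factor)
      have "norm (r i) < 1" if "i < n" for i
        using that by (intro norm_root_less_1[OF z]) (auto simp: r poly_prod)
      then have lt: "norm (Moebius_function 0 w (r i)) < 1" if "i < n" for i
        using that w1 by (intro Moebius_function_norm_lt_1) auto
      have "norm (?h z) = (\<Prod>i<n. norm (Moebius_function 0 w (r i)))"
        by (simp add: r poly_prod Moebius_function_simple norm_divide norm_minus_commute
            flip: prod_norm prod_dividef)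
      also have "\<dots> < (\<Prod>i<n. 1)"
        using lt n by (intro prod_mono_strict[of 0]) (auto intro: less_imp_le)
      finally show ?thesis by simp
    qed
    show "?h b = 0"
      using w by simp
  qed
  moreover have "?h a = w ^ n"
    by (simp add: fa poly_symm_poly poly_recip_poly)
  ultimately show ?thesis
    by (simp add: norm_power norm_Moebius_function_commute)
qed

end

text \<open>A scale strictly above all root moduli is admissible. As a root may attain the bound
  \<open>m\<close>, the n-th root of \<open>m + e\<close> is used for each
  \<open>e > 0\<close>.\<close>

lemma Inf_power_scales_le:
  assumes "n > 0" and roots: "\<And>w. poly (symm_poly n s) w = 0 \<Longrightarrow> norm w ^ n \<le> m" and "m \<ge> 0"
  shows "Inf {t ^ n | t. t \<in> admissible_scales n s} \<le> m"
proof (rule field_le_epsilon)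
  fix e :: real assume "e > 0"
  define t where "t = root n (m + e)"
  have t: "t > 0" "t ^ n = m + e"
    using \<open>e > 0\<close> \<open>m \<ge> 0\<close> \<open>n > 0\<close> by (simp_all add: t_def)
  have "t \<in> admissible_scales n s"
  proof (rule admissible_if_roots_less[OF \<open>n > 0\<close> \<open>t > 0\<close>])
    fix w assume "poly (symm_poly n s) w = 0"
    then have "norm w ^ n \<le> m" by (rule roots)
    then have "norm w ^ n < t ^ n"
      unfolding t(2) using \<open>e > 0\<close> by linarith
    then show "norm w < t"
      by (rule power_less_imp_less_base) (use t in simp)
  qed
  then have "t ^ n \<in> {t ^ n | t. t \<in> admissible_scales n s}"
    by auto
  moreover have "bdd_below {t ^ n | t. t \<in> admissible_scales n s}"
    by (rule bdd_belowI[of _ 0]) (auto simp: admissible_scales_def)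
  ultimately show "Inf {t ^ n | t. t \<in> admissible_scales n s} \<le> m + e"
    unfolding t(2)[symmetric] by (rule cInf_lower)
qed

section \<open>Construction of a map by scaling the roots\<close>

lemma symm_polydisc_scale:
  assumes s: "s \<in> cspace n" and roots: "\<And>w. poly (symm_poly n s) w = 0 \<Longrightarrow> norm (c * w) < 1"
  shows "(\<lambda>j. s j * c ^ j) \<in> symm_polydisc n"
  unfolding symm_polydisc_iff
proof (intro conjI allI impI)
  show "(\<lambda>j. s j * c ^ j) \<in> cspace n"
    using s by (simp add: cspace_def)
  fix w assume w: "poly (symm_poly n (\<lambda>j. s j * c ^ j)) w = 0"
  show "norm w < 1"
  proof (cases "c = 0")
    case True
    have "(\<Sum>j=1..n. (-1) ^ j * (s j * c ^ j) * w ^ (n - j)) = 0"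
      using True by (intro sum.neutral) auto
    with w have "w ^ n = 0"
      by (simp add: poly_symm_poly)
    then show ?thesis by simp
  next
    case False
    have "c ^ n * ((-1) ^ j * s j * (w / c) ^ (n - j)) = (-1) ^ j * (s j * c ^ j) * w ^ (n - j)"
      if "j \<in> {1..n}" for j
      using that False by (simp add: power_divide power_diff)
    \<comment> \<open>Up to sign conventions \<open>s j\<close> is homogeneous of degree
      \<open>j\<close> in the roots, so the factors \<open>c ^ j\<close> multiply every root by
      \<open>c\<close>.\<close>
    then have "c ^ n * poly (symm_poly n s) (w / c) = poly (symm_poly n (\<lambda>j. s j * c ^ j)) w"
      using False
      by (simp add: poly_symm_poly distrib_left sum_distrib_left power_divide del: One_nat_def)
    with w False have "poly (symm_poly n s) (w / c) = 0" by simp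
    from roots[OF this] False show ?thesis by simp
  qed
qed

text \<open>For the degenerate case of equal base points, where the bound forces all roots to be 0.
  Then the product for \<open>recip_poly\<close> is 1, and its higher coefficients are the
  \<open>s j\<close> up to sign.\<close>

lemma eq_0_if_roots_0:
  assumes s: "s \<in> cspace n" and roots: "\<And>w. poly (symm_poly n s) w = 0 \<Longrightarrow> w = 0"
  shows "s = (\<lambda>_. 0)"
proof
  fix j
  obtain r where r: "symm_poly n s = (\<Prod>i<n. [:- r i, 1:])"
      "recip_poly n s = (\<Prod>i<n. [:1, - r i:])"
    by (rule symm_poly_factor)
  have r0: "r i = 0" if "i < n" for i
    by (rule roots) (use that in \<open>auto simp: r poly_prod\<close>)
  have "recip_poly n s = 1"
    unfolding r(2) by (rule prod.neutral) (auto simp: r0 one_pCons)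
  then have *: "coeff (\<Sum>j=1..n. monom ((-1) ^ j * s j) j) j = 0"
    by (simp add: recip_poly_def)
  show "s j = 0"
  proof (cases "j \<in> {1..n}")
    case True
    with * show ?thesis
      by (simp add: coeff_sum sum.delta cong: if_cong del: One_nat_def)
  qed (use s in \<open>simp add: cspace_def\<close>)
qed

lemma exists_map_if_roots_le:
  assumes s: "s \<in> symm_polydisc n" and ab: "a \<in> ball 0 1" "b \<in> ball 0 1"
    and roots: "\<And>w. poly (symm_poly n s) w = 0 \<Longrightarrow> norm w \<le> norm (Moebius_function 0 a b)"
  shows "\<exists>f \<in> holomorphic_maps (ball 0 1) (symm_polydisc n). f a = (\<lambda>_. 0) \<and> f b = s"
proof
  have sc: "s \<in> cspace n"
    using s by (simp add: symm_polydisc_iff)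
  define \<alpha> where "\<alpha> = Moebius_function 0 a b"
  \<comment> \<open>The scaling factor is 0 at \<open>a\<close>, 1 at \<open>b\<close> if \<alpha>
    is nonzero, and below 1 / |\<alpha>| in modulus on the disc. For \<alpha> = 0 division by zero
    makes the factor 0, so \<open>f\<close> is constantly the origin.\<close>
  define f where "f = (\<lambda>z j. s j * (Moebius_function 0 a z / \<alpha>) ^ j)"
  show "f \<in> holomorphic_maps (ball 0 1) (symm_polydisc n)"
    unfolding holomorphic_maps_def
  proof (intro CollectI conjI ballI allI)
    fix z :: complex assume z: "z \<in> ball 0 1"
    show "f z \<in> symm_polydisc n"
      unfolding f_def
    proof (rule symm_polydisc_scale[OF sc])
      fix w assume "poly (symm_poly n s) w = 0"
      then have w: "norm w \<le> norm \<alpha>"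
        using roots by (simp add: \<alpha>_def)
      have M: "norm (Moebius_function 0 a z) < 1"
        using ab z by (intro Moebius_function_norm_lt_1) auto
      show "norm (Moebius_function 0 a z / \<alpha> * w) < 1"
      proof (cases "\<alpha> = 0")
        case False
        have "norm (Moebius_function 0 a z / \<alpha> * w)
            = norm (Moebius_function 0 a z) * (norm w / norm \<alpha>)"
          by (simp add: norm_mult norm_divide)
        also have "\<dots> \<le> norm (Moebius_function 0 a z) * 1"
          using w False by (intro mult_left_mono) auto
        finally show ?thesis using M by simp
      qed simp
    qed
  next
    fix j show "(\<lambda>z. f z j) holomorphic_on ball 0 1"
      unfolding f_def using ab Moebius_function_holomorphic[of a 0]
      by (cases "\<alpha> = 0") (auto intro!: holomorphic_intros)
  qed
  \<comment> \<open>At \<open>j = 0\<close> the power is 1, and the coordinate vanishes because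
    \<open>s 0 = 0\<close>.\<close>
  have "f a j = 0" for j
    using sc by (cases "j = 0") (auto simp: f_def Moebius_function_eq_zero cspace_def)
  moreover have "f b = s"
  proof (cases "\<alpha> = 0")
    case True
    then have "s = (\<lambda>_. 0)"
      using roots by (intro eq_0_if_roots_0[OF sc]) (auto simp: \<alpha>_def)
    then show ?thesis by (simp add: f_def)
  qed (simp add: f_def flip: \<alpha>_def)
  ultimately show "f a = (\<lambda>_. 0) \<and> f b = s" by auto
qed

theorem theorem1p7:
  fixes n :: nat and s :: "nat \<Rightarrow> complex" and \<zeta>1 \<zeta>2 :: complex
  assumes "n \<ge> 2"
    and "\<zeta>1 \<in> ball 0 1" and "\<zeta>2 \<in> ball 0 1"
    and "s \<in> symm_polydisc n"
  shows "((\<exists>f \<in> holomorphic_maps (ball 0 1) (symm_polydisc n). f \<zeta>1 = (\<lambda>_. 0) \<and> f \<zeta>2 = s) \<longrightarrow>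
            max (Inf {t ^ n | t. t \<in> admissible_scales n s})
                (SUP z\<in>sphere 0 1. norm (F n s z))
              \<le> norm ((\<zeta>2 - \<zeta>1) / (1 - cnj \<zeta>1 * \<zeta>2)))
       \<and> (Inf (admissible_scales n s) \<le> norm ((\<zeta>2 - \<zeta>1) / (1 - cnj \<zeta>1 * \<zeta>2)) \<longrightarrow>
            (\<exists>f \<in> holomorphic_maps (ball 0 1) (symm_polydisc n). f \<zeta>1 = (\<lambda>_. 0) \<and> f \<zeta>2 = s))"
  unfolding Moebius_function_simple[symmetric]
proof (intro conjI impI)
  have n: "n > 0" using assms(1) by simp
  {
    assume "\<exists>f \<in> holomorphic_maps (ball 0 1) (symm_polydisc n). f \<zeta>1 = (\<lambda>_. 0) \<and> f \<zeta>2 = s"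
    then obtain f where f: "f \<in> holomorphic_maps (ball 0 1) (symm_polydisc n)"
        "f \<zeta>1 = (\<lambda>_. 0)" "f \<zeta>2 = s"
      by blast
    note f_bounds = norm_F_le[OF n f(1) assms(2,3) f(2), unfolded f(3)]
      norm_root_power_le[OF n f(1) assms(2,3) f(2), unfolded f(3)]
    show "max (Inf {t ^ n | t. t \<in> admissible_scales n s})
        (SUP z\<in>sphere 0 1. norm (F n s z)) \<le> norm (Moebius_function 0 \<zeta>1 \<zeta>2)"
      using f_bounds n by (auto intro!: Inf_power_scales_le cSUP_least)
  next
    assume le: "Inf (admissible_scales n s) \<le> norm (Moebius_function 0 \<zeta>1 \<zeta>2)"
    \<comment> \<open>The set of scales is thus nonempty, so its infimum is at least every lower
      bound, in particular the modulus of each root.\<close>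
    have "1 \<in> admissible_scales n s"
      using assms(4) by (intro admissible_if_roots_less n) (auto simp: symm_polydisc_iff)
    then have "norm w \<le> Inf (admissible_scales n s)" if "poly (symm_poly n s) w = 0" for w
      using roots_less_if_admissible[OF n _ that] by (intro cInf_greatest) (auto intro: less_imp_le)
    with le show "\<exists>f \<in> holomorphic_maps (ball 0 1) (symm_polydisc n). f \<zeta>1 = (\<lambda>_. 0) \<and> f \<zeta>2 = s"
      using assms by (intro exists_map_if_roots_le) (auto intro: order_trans)
  }
qed

end
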